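(* Let $(X,d)$ be a metric space, and let $\mu$ be an Ahlfors $s$-regular measure on $X$ for some $s\in(0,\infty)$. Let $(Y,\rho)$ be a metric space. Let $0<r<1$ and $0<q<\infty$ be such that $rq\le s$, and let $u\in W^{r,q}_{\mathrm{loc}}(X,\mu;Y)$. Then $\mathcal H^{s-rq}$-almost every point $x\in X$ is an average Lebesgue point of $u$; that is, the set of points $x\in X$ for which $$\lim_{\varepsilon\to0^+}\frac{1}{\mu(B_\varepsilon(x))^2}\int_{B_\varepsilon(x)}\int_{B_\varepsilon(x)}\rho(u(z),u(v))^q\,d\mu(v)\,d\mu(z)=0$$ fails has $\mathcal H^{s-rq}$-measure zero.
   Context: $B_t(x)$ denotes the closed ball with center $x$ and radius $t\in(0,\infty)$. A Borel measure on $X$ is a positive outer measure for which all Borel sets are measurable. Ahlfors $s$-regular: a Borel measure $\mu$ on $X$ for which there are constants $c,C>0$ with $c\,t^s\le\mu(B_t(x))\le C\,t^s$ for all $x\in X$ and all $0<t<\operatorname{diam}(X)$. Every closed ball is assumed to have positive and finite $\mu$-measure. Local integrability: $F\in L^q_{\mathrm{loc}}(X\times X,\mu\times\mu)$ means $F$ is $\mu\times\mu$-measurable and $\int_B|F|^q\,d(\mu\times\mu)<\infty$ for every closed ball $B\subset X\times X$. Fractional Sobolev space: a $\mu$-measurable $u:X\to Y$ belongs to $W^{r,q}(X,\mu;Y)$ if $F_u(x,z):=\rho(u(x),u(z))$ belongs to $L^q_{\mathrm{loc}}(X\times X,\mu\times\mu)$ and $$\iint_{X\times X}\frac{\rho(u(x),u(z))^q}{d(x,z)^{rq+s}}\,d(\mu\times\mu)(x,z)<\infty.$$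 $u\in W^{r,q}_{\mathrm{loc}}(X,\mu;Y)$ means that $u:X\to Y$ is $\mu$-measurable and $u\in W^{r,q}(B,\mu;Y)$ for every ball $B\subset X$, i.e. for every ball $B\subset X$ the function $F_u(x,z)=\rho(u(x),u(z))$ belongs to $L^q_{\mathrm{loc}}(B\times B,\mu\times\mu)$ and $$\iint_{B\times B}\frac{\rho(u(x),u(z))^q}{d(x,z)^{rq+s}}\,d(\mu\times\mu)(x,z)<\infty,$$ with the same exponent $s$. Hausdorff measure: for $\alpha\in[0,\infty)$, $\mathcal H^\alpha(E)=\lim_{\delta\to0^+}\mathcal H^\alpha_\delta(E)$ with $\mathcal H^\alpha_\delta(E)=\inf\{\sum_{i=1}^\infty(\operatorname{diam}E_i)^\alpha: E\subset\bigcup_iE_i,\ \operatorname{diam}(E_i)\le\delta\}$ (with the usual convention that $\mathcal H^0$ is counting measure). *)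

theory Defs
  imports "HOL-Analysis.Analysis"
begin

text \<open>
  Measures on \<open>X\<close> are outer measures, defined on all subsets; measurability is in the sense of
  Caratheodory.  No Borel regularity is assumed.
\<close>

definition borel_outer_measure :: "('a::topological_space set \<Rightarrow> ennreal) \<Rightarrow> bool" where
  "borel_outer_measure \<mu> \<longleftrightarrow>
     outer_measure_space (Pow UNIV) \<mu> \<and> sets borel \<subseteq> lambda_system UNIV (Pow UNIV) \<mu>"

definition caratheodory_measure :: "('a set \<Rightarrow> ennreal) \<Rightarrow> 'a measure" where
  "caratheodory_measure \<mu> = measure_of UNIV (lambda_system UNIV (Pow UNIV) \<mu>) \<mu>"

lemma measure_space_lambda_system:
  assumes "outer_measure_space (Pow UNIV) \<mu>"
  shows "measure_space UNIV (lambda_system UNIV (Pow UNIV) \<mu>) \<mu>"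
  using sigma_algebra.caratheodory_lemma[OF sigma_algebra_Pow assms] .

lemma space_caratheodory_measure [simp]: "space (caratheodory_measure \<mu>) = UNIV"
  unfolding caratheodory_measure_def by (rule space_measure_of) simp

lemma sets_caratheodory_measure:
  assumes "outer_measure_space (Pow UNIV) \<mu>"
  shows "sets (caratheodory_measure \<mu>) = lambda_system UNIV (Pow UNIV) \<mu>"
  using measure_space_lambda_system[OF assms]
  unfolding caratheodory_measure_def measure_space_def
  by (elim conjE) (rule sigma_algebra.sets_measure_of_eq)

lemma emeasure_caratheodory_measure:
  assumes "outer_measure_space (Pow UNIV) \<mu>" "A \<in> lambda_system UNIV (Pow UNIV) \<mu>"
  shows "emeasure (caratheodory_measure \<mu>) A = \<mu> A"
  using measure_space_lambda_system[OF assms(1)] assms(2)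
  unfolding caratheodory_measure_def measure_space_def
  by (elim conjE) (rule emeasure_measure_of_sigma)

text \<open>
  The measurable sets of the product outer measure \<open>\<mu> \<times> \<mu>\<close> of a sigma-finite \<open>\<mu>\<close> form the completion
  of the product sigma-algebra, not the product sigma-algebra itself.
\<close>

definition product_measure :: "('a set \<Rightarrow> ennreal) \<Rightarrow> ('a \<times> 'a) measure" where
  "product_measure \<mu> = completion (caratheodory_measure \<mu> \<Otimes>\<^sub>M caratheodory_measure \<mu>)"

text \<open>The library's \<^const>\<open>diameter\<close> is real-valued and unspecified on unbounded sets.\<close>

definition ediameter :: "'a::metric_space set \<Rightarrow> ennreal" where
  "ediameter S = (if bounded S then ennreal (diameter S) else \<infinity>)"

definition ahlfors_regular :: "real \<Rightarrow> ('a::metric_space set \<Rightarrow> ennreal) \<Rightarrow> bool" where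
  "ahlfors_regular s \<mu> \<longleftrightarrow> borel_outer_measure \<mu> \<and>
     (\<exists>c>0. \<exists>C>0. \<forall>x. \<forall>t>0. ennreal t < ediameter (UNIV :: 'a set) \<longrightarrow>
        ennreal (c * t powr s) \<le> \<mu> (cball x t) \<and> \<mu> (cball x t) \<le> ennreal (C * t powr s))"

text \<open>
  In the following two definitions \<open>A\<close> is regarded as a metric space in its own right, so the closed
  balls of \<open>A \<times> A\<close> are the traces of closed balls centred in \<open>A \<times> A\<close>.
\<close>

definition Lq_loc :: "real \<Rightarrow> ('a::metric_space set \<Rightarrow> ennreal) \<Rightarrow> 'a set \<Rightarrow> ('a \<times> 'a \<Rightarrow> real) \<Rightarrow> bool"
  where
  "Lq_loc q \<mu> A F \<longleftrightarrow>
     F \<in> borel_measurable (restrict_space (product_measure \<mu>) (A \<times> A)) \<and>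
     (\<forall>p\<in>A \<times> A. \<forall>R>0.
        (\<integral>\<^sup>+y\<in>cball p R \<inter> A \<times> A. ennreal (\<bar>F y\<bar> powr q) \<partial>product_measure \<mu>) < \<infinity>)"

text \<open>On the diagonal the integrand of the energy is \<open>0 / 0 = 0\<close>.\<close>

definition frac_sobolev ::
  "real \<Rightarrow> real \<Rightarrow> real \<Rightarrow> ('a::metric_space set \<Rightarrow> ennreal) \<Rightarrow> 'a set \<Rightarrow> ('a \<Rightarrow> 'b::metric_space) \<Rightarrow> bool"
  where
  "frac_sobolev s r q \<mu> A u \<longleftrightarrow>
     u \<in> borel_measurable (restrict_space (caratheodory_measure \<mu>) A) \<and>
     Lq_loc q \<mu> A (\<lambda>(x, z). dist (u x) (u z)) \<and>
     (\<integral>\<^sup>+(x, z)\<in>A \<times> A. ennreal (dist (u x) (u z) powr q / dist x z powr (r * q + s))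
        \<partial>product_measure \<mu>) < \<infinity>"

definition frac_sobolev_loc ::
  "real \<Rightarrow> real \<Rightarrow> real \<Rightarrow> ('a::metric_space set \<Rightarrow> ennreal) \<Rightarrow> ('a \<Rightarrow> 'b::metric_space) \<Rightarrow> bool"
  where
  "frac_sobolev_loc s r q \<mu> u \<longleftrightarrow>
     u \<in> borel_measurable (caratheodory_measure \<mu>) \<and>
     (\<forall>x. \<forall>t>0. frac_sobolev s r q \<mu> (cball x t) u)"

text \<open>
  \<open>(diam E)\<^sup>\<alpha>\<close>, used for bounded \<open>E\<close> only.  For \<open>\<alpha> = 0\<close> it has to be \<open>1\<close> on singletons, whereas
  \<^term>\<open>0 powr 0 = (0::real)\<close>.
\<close>

definition diam_pow :: "real \<Rightarrow> 'a::metric_space set \<Rightarrow> ennreal" where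
  "diam_pow \<alpha> E =
     (if E = {} then 0 else if \<alpha> = 0 then 1 else ennreal (diameter E powr \<alpha>))"

definition hausdorff_content :: "real \<Rightarrow> real \<Rightarrow> 'a::metric_space set \<Rightarrow> ennreal" where
  "hausdorff_content \<alpha> \<delta> E =
     (INF S\<in>{S :: nat \<Rightarrow> 'a set. E \<subseteq> (\<Union>i. S i) \<and> (\<forall>i. ediameter (S i) \<le> ennreal \<delta>)}.
        \<Sum>i. diam_pow \<alpha> (S i))"

definition hausdorff_measure :: "real \<Rightarrow> 'a::metric_space set \<Rightarrow> ennreal" where
  "hausdorff_measure \<alpha> E = Lim (at_right 0) (\<lambda>\<delta>. hausdorff_content \<alpha> \<delta> E)"

lemma hausdorff_content_antimono:
  assumes "\<delta> \<le> \<delta>'"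
  shows "hausdorff_content \<alpha> \<delta>' E \<le> hausdorff_content \<alpha> \<delta> E"
  unfolding hausdorff_content_def
  using assms by (intro INF_superset_mono) (auto intro: order_trans ennreal_leI)

lemma hausdorff_measure_eq_SUP:
  "hausdorff_measure \<alpha> E = (SUP \<delta>\<in>{0<..}. hausdorff_content \<alpha> \<delta> E)"
proof -
  have "((\<lambda>\<delta>. hausdorff_content \<alpha> \<delta> E) \<longlongrightarrow> (SUP \<delta>\<in>{0<..}. hausdorff_content \<alpha> \<delta> E)) (at_right 0)"
  proof (rule order_tendstoI)
    fix a assume "a < (SUP \<delta>\<in>{0<..}. hausdorff_content \<alpha> \<delta> E)"
    then obtain d where d: "0 < d" "a < hausdorff_content \<alpha> d E"
      by (auto simp: less_SUP_iff)
    show "\<forall>\<^sub>F \<delta> in at_right 0. a < hausdorff_content \<alpha> \<delta> E"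
      unfolding eventually_at_right_field
      using d by (intro exI[of _ d])
        (auto intro: less_le_trans hausdorff_content_antimono less_imp_le)
  next
    fix a assume *: "(SUP \<delta>\<in>{0<..}. hausdorff_content \<alpha> \<delta> E) < a"
    have "hausdorff_content \<alpha> \<delta> E < a" if "0 < \<delta>" for \<delta>
      using that by (intro le_less_trans[OF _ *] SUP_upper) auto
    then show "\<forall>\<^sub>F \<delta> in at_right 0. hausdorff_content \<alpha> \<delta> E < a"
      unfolding eventually_at_right_field by (intro exI[of _ 1]) auto
  qed
  then show ?thesis
    unfolding hausdorff_measure_def by (intro tendsto_Lim) auto
qed

definition average_lebesgue_point ::
  "real \<Rightarrow> ('a::metric_space set \<Rightarrow> ennreal) \<Rightarrow> ('a \<Rightarrow> 'b::metric_space) \<Rightarrow> 'a \<Rightarrow> bool"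
  where
  "average_lebesgue_point q \<mu> u x \<longleftrightarrow>
     ((\<lambda>\<epsilon>. (\<integral>\<^sup>+z\<in>cball x \<epsilon>. (\<integral>\<^sup>+v\<in>cball x \<epsilon>. ennreal (dist (u z) (u v) powr q)
                \<partial>caratheodory_measure \<mu>) \<partial>caratheodory_measure \<mu>) / (\<mu> (cball x \<epsilon>))\<^sup>2)
       \<longlongrightarrow> 0) (at_right 0)"

end

theory Submission
  imports Defs
begin

text \<open>
  Let \<open>E\<close> be the set of points \<open>x\<close> of a fixed ball at which the mean oscillation of \<open>u\<close> exceeds
  \<open>\<theta>\<close> at arbitrarily small scales.  By regularity each \<open>x \<in> E\<close> has arbitrarily small balls \<open>B\<close> of
  radius \<open>\<epsilon>\<close> such that \<open>\<epsilon> powr (s - r * q)\<close> is at most a constant times the energy of \<open>u\<close> on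
  \<open>B \<times> B\<close>.  Choose balls of radius less than \<open>R\<close> and apply the Vitali covering argument: the
  products \<open>B \<times> B\<close> of the selected balls are disjoint and lie in \<open>{(x, z). dist x z \<le> 2 * R}\<close>, so
  the Hausdorff content of \<open>E\<close> at scale \<open>6 * R\<close> is controlled by the energy near the diagonal.
  The energy is finite and its integrand vanishes on the diagonal, so this tends to \<open>0\<close> with \<open>R\<close>.
\<close>

section \<open>The Vitali covering argument\<close>

text \<open>Zorn's lemma gives a maximal family \<open>D\<close> of disjoint balls with this
  invariant: a ball that meets \<open>D\<close> meets a member of at least half its radius.
  Maximality then forces every ball to meet \<open>D\<close>. Only centres have to be covered, so
  enlarging by 3 is enough: a common point gives
  \<open>dist y x \<le> e y + e x \<le> 3 * e y\<close>. No separability is assumed, so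
  \<open>D\<close> may be uncountable.\<close>

lemma vitali_covering_metric:
  fixes e :: "'a::metric_space \<Rightarrow> real"
  assumes e: "\<And>x. x \<in> E \<Longrightarrow> 0 < e x" "\<And>x. x \<in> E \<Longrightarrow> e x \<le> R"
  obtains D where "D \<subseteq> E" "disjoint_family_on (\<lambda>x. cball x (e x)) D"
    "E \<subseteq> (\<Union>x\<in>D. cball x (3 * e x))"
proof -
  define B where "B = (\<lambda>x. cball x (e x))"
  \<comment> \<open>The condition concerns only balls that already meet \<open>D\<close>. Hence the
    empty family satisfies it, and it passes to unions of chains, where a witness in one member
    remains a witness.\<close>
  define good where "good = (\<lambda>D. \<forall>x\<in>E. (\<exists>y\<in>D. B x \<inter> B y \<noteq> {}) \<longrightarrow>
    (\<exists>y\<in>D. B x \<inter> B y \<noteq> {} \<and> e x \<le> 2 * e y))"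
  define \<Omega> where "\<Omega> = {D. D \<subseteq> E \<and> disjoint_family_on B D \<and> good D}"
  have "\<Union>C \<in> \<Omega>" if C: "subset.chain \<Omega> C" for C
  proof -
    have C\<Omega>: "D \<subseteq> E" "disjoint_family_on B D" "good D" if "D \<in> C" for D
      using C that by (auto simp: subset_chain_def \<Omega>_def)
    have lin: "D \<subseteq> D' \<or> D' \<subseteq> D" if "D \<in> C" "D' \<in> C" for D D'
      using C that by (auto simp: subset_chain_def)
    have "disjoint_family_on B (\<Union>C)"
      unfolding disjoint_family_on_def
    proof (intro ballI impI)
      fix x y assume "x \<in> \<Union>C" "y \<in> \<Union>C" "x \<noteq> y"
      then obtain D where "D \<in> C" "x \<in> D" "y \<in> D" using lin by blast
      then show "B x \<inter> B y = {}"
        using C\<Omega>(2)[of D] \<open>x \<noteq> y\<close> by (auto simp: disjoint_family_on_def)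
    qed
    moreover have "good (\<Union>C)"
      unfolding good_def
    proof (intro ballI impI)
      fix x assume "x \<in> E" "\<exists>y\<in>\<Union>C. B x \<inter> B y \<noteq> {}"
      then obtain D y where D: "D \<in> C" "y \<in> D" "B x \<inter> B y \<noteq> {}" by blast
      then obtain y' where "y' \<in> D" "B x \<inter> B y' \<noteq> {}" "e x \<le> 2 * e y'"
        using C\<Omega>(3)[of D] \<open>x \<in> E\<close> unfolding good_def by blast
      then show "\<exists>y\<in>\<Union>C. B x \<inter> B y \<noteq> {} \<and> e x \<le> 2 * e y" using D by blast
    qed
    ultimately show ?thesis using C\<Omega>(1) by (auto simp: \<Omega>_def)
  qed
  from subset_Zorn'[OF this] obtain D where
    D: "D \<in> \<Omega>" and max: "\<And>D'. D' \<in> \<Omega> \<Longrightarrow> D \<subseteq> D' \<Longrightarrow> D' = D" by blast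
  have DE: "D \<subseteq> E" and disj: "disjoint_family_on B D" and good: "good D"
    using D by (auto simp: \<Omega>_def)
  have meets: "\<exists>y\<in>D. B x \<inter> B y \<noteq> {}" if x: "x \<in> E" for x
  proof (rule ccontr)
    assume no: "\<not> (\<exists>y\<in>D. B x \<inter> B y \<noteq> {})"
    \<comment> \<open>Balls outside \<open>T\<close> already meet \<open>D\<close> and keep their
      witness. Adding a centre of \<open>T\<close> whose radius exceeds half the supremum over
      \<open>T\<close> also provides a witness for every ball of \<open>T\<close> that meets the new
      one. The bound \<open>R\<close> makes the supremum finite. The enlarged family contradicts
      maximality.\<close>
    define T where "T = {x\<in>E. \<forall>y\<in>D. B x \<inter> B y = {}}"
    have "x \<in> T" using no x by (auto simp: T_def)
    have bdd: "bdd_above (e ` T)" using e(2) by (intro bdd_aboveI[of _ R]) (auto simp: T_def)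
    have Sup: "e y \<le> Sup (e ` T)" if "y \<in> T" for y
      using bdd that by (intro cSup_upper) auto
    have "Sup (e ` T) / 2 < Sup (e ` T)"
      using e(1)[OF x] Sup[OF \<open>x \<in> T\<close>] by simp
    then obtain x1 where x1: "x1 \<in> T" "Sup (e ` T) / 2 < e x1"
      using less_cSup_iff[of "e ` T" "Sup (e ` T) / 2"] bdd \<open>x \<in> T\<close> by blast
    have x1E: "x1 \<in> E" using x1 by (auto simp: T_def)
    have "good (insert x1 D)"
      unfolding good_def
    proof (intro ballI impI)
      fix z assume z: "z \<in> E" "\<exists>y\<in>insert x1 D. B z \<inter> B y \<noteq> {}"
      show "\<exists>y\<in>insert x1 D. B z \<inter> B y \<noteq> {} \<and> e z \<le> 2 * e y"
      proof (cases "z \<in> T")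
        case True
        with z have "B z \<inter> B x1 \<noteq> {}" by (auto simp: T_def)
        moreover have "e z \<le> 2 * e x1" using Sup[OF True] x1(2) by linarith
        ultimately show ?thesis by blast
      next
        case False
        with z(1) have "\<exists>y\<in>D. B z \<inter> B y \<noteq> {}" by (auto simp: T_def)
        with good z(1) show ?thesis unfolding good_def by blast
      qed
    qed
    moreover have "disjoint_family_on B (insert x1 D)"
      using disj x1(1) by (auto simp: disjoint_family_on_def T_def)
    ultimately have "insert x1 D \<in> \<Omega>" using DE x1E by (auto simp: \<Omega>_def)
    with max have "x1 \<in> D" by blast
    with x1(1) have "B x1 = {}" by (auto simp: T_def)
    then show False using e(1)[OF x1E] by (auto simp: B_def)
  qed
  have "x \<in> (\<Union>y\<in>D. cball y (3 * e y))" if x: "x \<in> E" for x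
  proof -
    from good meets[OF x] x obtain y w where
      y: "y \<in> D" "w \<in> B x" "w \<in> B y" "e x \<le> 2 * e y" unfolding good_def by blast
    then have "dist y x \<le> 3 * e y"
      using dist_triangle[of y x w] by (auto simp: B_def dist_commute)
    then show ?thesis using y(1) by auto
  qed
  then show ?thesis using that[OF DE] disj unfolding B_def by blast
qed

section \<open>Null sets of the content, iterated integrals and elementary estimates\<close>

lemma hausdorff_content_countable_Union_null:
  assumes null: "\<And>i::nat. hausdorff_content \<alpha> \<delta> (E i) = 0"
  shows "hausdorff_content \<alpha> \<delta> (\<Union>i. E i) = 0"
proof -
  have "hausdorff_content \<alpha> \<delta> (\<Union>i. E i) \<le> ennreal \<epsilon>" if \<epsilon>: "\<epsilon> > 0" for \<epsilon>
  proof -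
    have "\<exists>S :: nat \<Rightarrow> 'a set. E i \<subseteq> (\<Union>j. S j) \<and> (\<forall>j. ediameter (S j) \<le> ennreal \<delta>) \<and>
        (\<Sum>j. diam_pow \<alpha> (S j)) < ennreal (\<epsilon> * (1/2) ^ Suc i)" for i
    proof -
      have "hausdorff_content \<alpha> \<delta> (E i) < ennreal (\<epsilon> * (1/2) ^ Suc i)"
        using null[of i] \<epsilon> by simp
      then show ?thesis unfolding hausdorff_content_def INF_less_iff by auto
    qed
    then obtain S :: "nat \<Rightarrow> nat \<Rightarrow> 'a set" where
      S: "\<And>i. E i \<subseteq> (\<Union>j. S i j)" "\<And>i j. ediameter (S i j) \<le> ennreal \<delta>"
        "\<And>i. (\<Sum>j. diam_pow \<alpha> (S i j)) < ennreal (\<epsilon> * (1/2) ^ Suc i)" by metis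
    define T where "T n = (case prod_decode n of (i, j) \<Rightarrow> S i j)" for n
    have "(\<Union>i. E i) \<subseteq> (\<Union>n. T n)"
    proof
      fix x assume "x \<in> (\<Union>i. E i)"
      then obtain i j where "x \<in> S i j" using S(1) by blast
      then have "x \<in> T (prod_encode (i, j))" by (simp add: T_def)
      then show "x \<in> (\<Union>n. T n)" by blast
    qed
    moreover have "ediameter (T n) \<le> ennreal \<delta>" for n
      by (simp add: T_def S(2) split: prod.split)
    ultimately have "hausdorff_content \<alpha> \<delta> (\<Union>i. E i) \<le> (\<Sum>n. diam_pow \<alpha> (T n))"
      unfolding hausdorff_content_def by (intro INF_lower) auto
    also have "\<dots> = (\<Sum>n. (\<lambda>(i, j). diam_pow \<alpha> (S i j)) (prod_decode n))"
      by (simp add: T_def split_beta)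
    also have "\<dots> = (\<Sum>i. \<Sum>j. diam_pow \<alpha> (S i j))"
      by (rule suminf_ennreal_2dimen) simp
    also have "\<dots> \<le> (\<Sum>i. ennreal (\<epsilon> * (1/2) ^ Suc i))"
      using S(3) by (intro suminf_le) (auto intro: less_imp_le)
    also have "\<dots> = ennreal \<epsilon>"
      using sums_mult[OF power_half_series, of \<epsilon>] \<epsilon>
      by (intro suminf_ennreal_eq) auto
    finally show ?thesis .
  qed
  then show ?thesis
    by (metis ennreal_le_epsilon ennreal_0 add.left_neutral le_zero_eq)
qed

text \<open>Sections of \<open>f\<close> may fail to be measurable, so Tonelli is applied to a
  product-measurable \<open>g\<close> that agrees with \<open>f\<close> almost everywhere. For
  almost every \<open>x\<close> the sections of \<open>f\<close> and \<open>g\<close> agree almost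
  everywhere, so the iterated integrals coincide.\<close>

lemma iterated_nn_integral_completion:
  assumes "sigma_finite_measure M" and f: "f \<in> borel_measurable (completion (M \<Otimes>\<^sub>M M))"
  shows "(\<integral>\<^sup>+x. \<integral>\<^sup>+y. f (x, y) \<partial>M \<partial>M) = (\<integral>\<^sup>+p. f p \<partial>completion (M \<Otimes>\<^sub>M M))"
proof -
  interpret sigma_finite_measure M by fact
  note tonelli = nn_integral_fst
  interpret pair_sigma_finite M M ..
  obtain g where g: "g \<in> borel_measurable (M \<Otimes>\<^sub>M M)" and ae: "AE p in M \<Otimes>\<^sub>M M. f p = g p"
    using completion_ex_borel_measurable[OF f] by blast
  have "(\<integral>\<^sup>+x. \<integral>\<^sup>+y. f (x, y) \<partial>M \<partial>M) = (\<integral>\<^sup>+x. \<integral>\<^sup>+y. g (x, y) \<partial>M \<partial>M)"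
    using AE_pair[OF ae] by (intro nn_integral_cong_AE) (auto intro: nn_integral_cong_AE)
  also have "\<dots> = (\<integral>\<^sup>+p. g p \<partial>(M \<Otimes>\<^sub>M M))" by (rule tonelli[OF g])
  also have "\<dots> = (\<integral>\<^sup>+p. f p \<partial>(M \<Otimes>\<^sub>M M))" using ae by (intro nn_integral_cong_AE) auto
  finally show ?thesis by (simp add: nn_integral_completion)
qed

text \<open>Applied pointwise to functions with disjoint supports: their sum inherits a common upper
  bound without a factor.\<close>

lemma suminf_le_if_at_most_one_nonzero:
  fixes a :: "nat \<Rightarrow> ennreal"
  assumes "\<And>i. a i \<le> c" "\<And>i j. a i \<noteq> 0 \<Longrightarrow> a j \<noteq> 0 \<Longrightarrow> i = j"
  shows "(\<Sum>i. a i) \<le> c"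
proof (cases "\<exists>i. a i \<noteq> 0")
  case True
  then obtain i where i: "a i \<noteq> 0" by blast
  have "(\<Sum>j. a j) = (\<Sum>j\<in>{i}. a j)"
    using assms(2)[OF i] by (intro suminf_finite) auto
  then show ?thesis using assms(1) by simp
qed simp

lemma sum_le_if_at_most_one_nonzero:
  fixes a :: "'i \<Rightarrow> ennreal"
  assumes "finite I" "\<And>i. i \<in> I \<Longrightarrow> a i \<le> c"
    "\<And>i j. i \<in> I \<Longrightarrow> j \<in> I \<Longrightarrow> a i \<noteq> 0 \<Longrightarrow> a j \<noteq> 0 \<Longrightarrow> i = j"
  shows "sum a I \<le> c"
proof (cases "\<exists>i\<in>I. a i \<noteq> 0")
  case True
  then obtain i where i: "i \<in> I" "a i \<noteq> 0" by blast
  have "sum a I = sum a {i}"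
    using assms i by (intro sum.mono_neutral_right) auto
  then show ?thesis using assms(2) i by simp
qed simp

lemma diameter_cball_le:
  assumes "0 \<le> t"
  shows "diameter (cball x t) \<le> 2 * t"
proof -
  have "dist y z \<le> 2 * t" if "y \<in> cball x t" "z \<in> cball x t" for y z
    using that dist_triangle[of y z x] by (simp add: dist_commute)
  then show ?thesis
    using assms by (auto simp: diameter_def intro!: cSUP_least)
qed

lemma diam_pow_cball_le:
  assumes "0 < t" "0 \<le> \<alpha>"
  shows "diam_pow \<alpha> (cball x t) \<le> ennreal ((2 * t) powr \<alpha>)"
  using assms diameter_cball_le[of t x] diameter_ge_0[OF bounded_cball, of x t]
  by (auto simp: diam_pow_def intro!: ennreal_leI powr_mono2)

section \<open>From energy density on small balls to vanishing Hausdorff content\<close>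

text \<open>
  The integrand of the energy need not be measurable when the space is not separable.  The functions
  \<open>g\<close> below are measurable minorants of it, built from a disjoint family of balls.
\<close>

lemma hausdorff_content_le_minorant:
  fixes P :: "('a::metric_space \<times> 'a) measure" and G :: "'a \<times> 'a \<Rightarrow> ennreal"
  assumes G: "G \<in> borel_measurable P"
    and ball: "\<And>x t. cball x t \<times> cball x t \<in> sets P"
    and diag: "\<And>x. G (x, x) = 0"
    and energy: "(\<integral>\<^sup>+y. G y * ennreal (1 / dist (fst y) (snd y) powr p) \<partial>P) < \<infinity>"
    and "0 \<le> \<alpha>" "0 < p" "0 < \<kappa>" "0 < R"
    and E: "\<And>x \<delta>. x \<in> E \<Longrightarrow> 0 < \<delta> \<Longrightarrow> \<exists>e. 0 < e \<and> e < \<delta> \<and>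
      ennreal (\<kappa> * e powr (\<alpha> + p)) \<le> (\<integral>\<^sup>+y\<in>cball x e \<times> cball x e. G y \<partial>P)"
  obtains g where "g \<in> borel_measurable P"
    "\<And>y. g y \<le> G y * ennreal (1 / dist (fst y) (snd y) powr p)"
    "\<And>y. 2 * R < dist (fst y) (snd y) \<Longrightarrow> g y = 0"
    "hausdorff_content \<alpha> (6 * R) E \<le> ennreal (6 powr \<alpha> * 2 powr p / \<kappa>) * (\<integral>\<^sup>+y. g y \<partial>P)"
proof -
  define f where "f y = G y * ennreal (1 / dist (fst y) (snd y) powr p)" for y
  obtain e where e: "\<And>x. x \<in> E \<Longrightarrow> 0 < e x" "\<And>x. x \<in> E \<Longrightarrow> e x < R"
    "\<And>x. x \<in> E \<Longrightarrow>
      ennreal (\<kappa> * e x powr (\<alpha> + p)) \<le> (\<integral>\<^sup>+y\<in>cball x (e x) \<times> cball x (e x). G y \<partial>P)"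
    using bchoice[of E "\<lambda>x e. 0 < e \<and> e < R \<and> ennreal (\<kappa> * e powr (\<alpha> + p)) \<le>
      (\<integral>\<^sup>+y\<in>cball x e \<times> cball x e. G y \<partial>P)"] E[OF _ \<open>0 < R\<close>] by blast
  obtain D where D: "D \<subseteq> E" "disjoint_family_on (\<lambda>x. cball x (e x)) D"
    "E \<subseteq> (\<Union>x\<in>D. cball x (3 * e x))"
    by (rule vitali_covering_metric[of E e R]) (auto intro: less_imp_le e)
  define B where "B x = cball x (e x) \<times> cball x (e x)" for x
  \<comment> \<open>The coordinates of a point of \<open>B x\<close> are at most
    \<open>2 * e x\<close> apart, so the constant bounds the kernel from below on \<open>B x\<close>
    off the diagonal. Using the constant in place of the kernel makes \<open>h x\<close>
    measurable.\<close>
  define h where "h x y = G y * indicator (B x) y * ennreal (1 / (2 * e x) powr p)" for x y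
  \<comment> \<open>This is the density bound \<open>\<kappa> * e x powr (\<alpha> + p)\<close>
    divided by \<open>(2 * e x) powr p\<close>. It is therefore a lower bound for the integral of
    \<open>h x\<close>.\<close>
  define b where "b x = \<kappa> / 2 powr p * e x powr \<alpha>" for x
  have BP: "B x \<in> sets P" for x unfolding B_def by (rule ball)
  have h_meas [measurable]: "h x \<in> borel_measurable P" for x
    unfolding h_def using BP G by measurable
  have h_supp: "y \<in> B x" if "h x y \<noteq> 0" for x y
    using that by (auto simp: h_def indicator_def split: if_splits)
  have dist_B: "dist (fst y) (snd y) \<le> 2 * e x" if "y \<in> B x" for x y
    using that dist_triangle[of "fst y" "snd y" x] by (auto simp: B_def dist_commute)
  have h_le: "h x y \<le> f y" if "x \<in> E" for x y
  proof (cases "y \<in> B x \<and> fst y \<noteq> snd y")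
    case True
    then have "1 / (2 * e x) powr p \<le> 1 / dist (fst y) (snd y) powr p"
      using dist_B[of y x] \<open>0 < p\<close> e(1)[OF that] by (intro divide_left_mono powr_mono2) auto
    then show ?thesis
      using True unfolding h_def f_def by (auto intro!: mult_left_mono ennreal_leI)
  next
    \<comment> \<open>On the diagonal the kernel is \<open>1 / 0 = 0\<close>, so \<open>f\<close>
      vanishes there; the inequality survives because \<open>G\<close> does too.\<close>
    case False
    moreover have "G y = 0" if "fst y = snd y" using diag[of "fst y"] that by (metis prod.collapse)
    ultimately show ?thesis by (cases "y \<in> B x") (simp_all add: h_def)
  qed
  have h_disj: "x = x'" if "x \<in> D" "x' \<in> D" "h x y \<noteq> 0" "h x' y \<noteq> 0" for x x' y
  proof (rule ccontr)
    assume "x \<noteq> x'"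
    then have "cball x (e x) \<inter> cball x' (e x') = {}"
      using disjoint_family_onD[OF D(2)] that(1,2) by blast
    moreover have "fst y \<in> cball x (e x)" "fst y \<in> cball x' (e x')"
      using h_supp[OF that(3)] h_supp[OF that(4)] unfolding B_def mem_Times_iff by blast+
    ultimately show False by blast
  qed
  have b_pos: "0 < b x" if "x \<in> E" for x
    using e(1)[OF that] \<open>0 < \<kappa>\<close> by (simp add: b_def)
  then have b_nonneg: "0 \<le> b x" if "x \<in> E" for x
    using that by (simp add: less_imp_le)
  have b_le: "ennreal (b x) \<le> (\<integral>\<^sup>+y. h x y \<partial>P)" if "x \<in> E" for x
  proof -
    have "b x = \<kappa> * e x powr (\<alpha> + p) * (1 / (2 * e x) powr p)"
      using e(1)[OF that] by (simp add: b_def powr_add powr_mult field_simps)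
    then have "ennreal (b x) = ennreal (\<kappa> * e x powr (\<alpha> + p)) * ennreal (1 / (2 * e x) powr p)"
      using \<open>0 < \<kappa>\<close> by (simp only: ennreal_mult powr_ge_zero mult_nonneg_nonneg less_imp_le
        zero_le_divide_1_iff)
    also have "\<dots> \<le> (\<integral>\<^sup>+y\<in>B x. G y \<partial>P) * ennreal (1 / (2 * e x) powr p)"
      unfolding B_def by (intro mult_right_mono e(3) that) simp
    also have "\<dots> = (\<integral>\<^sup>+y. h x y \<partial>P)"
      unfolding h_def
      by (rule nn_integral_multc[symmetric])
         (intro borel_measurable_times_ennreal G borel_measurable_indicator BP)
    finally show ?thesis .
  qed
  \<comment> \<open>Finite energy is what makes \<open>D\<close> countable: finite sums of the
    positive numbers \<open>b x\<close> are uniformly bounded, since the functions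
    \<open>h x\<close> have disjoint supports and lie below \<open>f\<close>.\<close>
  have sum_le: "(\<Sum>x\<in>I. b x) \<le> enn2real (\<integral>\<^sup>+y. f y \<partial>P)" if I: "finite I" "I \<subseteq> D" for I
  proof -
    have "ennreal (\<Sum>x\<in>I. b x) = (\<Sum>x\<in>I. ennreal (b x))"
      using I D(1) by (intro sum_ennreal[symmetric]) (auto intro: b_nonneg)
    also have "\<dots> \<le> (\<Sum>x\<in>I. \<integral>\<^sup>+y. h x y \<partial>P)"
      using I D(1) by (intro sum_mono b_le) auto
    also have "\<dots> = (\<integral>\<^sup>+y. (\<Sum>x\<in>I. h x y) \<partial>P)"
      by (rule nn_integral_sum[symmetric]) (rule h_meas)
    also have "\<dots> \<le> (\<integral>\<^sup>+y. f y \<partial>P)"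
    proof (intro nn_integral_mono sum_le_if_at_most_one_nonzero)
      show "finite I" by fact
      show "h x y \<le> f y" if "x \<in> I" for x y using I D(1) that by (intro h_le) blast
      show "x = x'" if "x \<in> I" "x' \<in> I" "h x y \<noteq> 0" "h x' y \<noteq> 0" for x x' y
        using I that(1,2) by (intro h_disj[OF _ _ that(3,4)]) blast+
    qed
    finally have "ennreal (sum b I) \<le> ennreal (enn2real (\<integral>\<^sup>+y. f y \<partial>P))"
      using energy by (simp add: f_def)
    then show ?thesis by (simp only: ennreal_le_iff[OF enn2real_nonneg])
  qed
  have "b summable_on D"
  proof (rule nonneg_bounded_partial_sums_imp_summable_on)
    show "\<And>x. x \<in> D \<Longrightarrow> 0 \<le> b x" using D(1) b_nonneg by blast
    show "\<forall>\<^sub>F I in finite_subsets_at_top D. sum b I \<le> enn2real (\<integral>\<^sup>+y. f y \<partial>P)"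
      by (intro eventually_finite_subsets_at_top_weakI sum_le)
  qed
  from summable_countable_real[OF this] have "countable {x\<in>D. b x \<noteq> 0}" .
  also have "{x\<in>D. b x \<noteq> 0} = D" using b_pos D(1) by force
  finally have cD: "countable D" .
  \<comment> \<open>\<open>D\<close> may be finite, and then \<open>from_nat_into\<close> repeats
    points. Indices outside \<open>N\<close> contribute zero functions and empty sets, which keeps
    the enumeration injective where it matters.\<close>
  define N where "N = to_nat_on D ` D"
  define c where "c = from_nat_into D"
  have c: "c n \<in> D" "to_nat_on D (c n) = n" if "n \<in> N" for n
    using that cD by (auto simp: N_def c_def)
  define g where "g y = (\<Sum>n. if n \<in> N then h (c n) y else 0)" for y
  define S where "S n = (if n \<in> N then cball (c n) (3 * e (c n)) else {})" for n
  show ?thesis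
  proof
    show "g \<in> borel_measurable P"
      unfolding g_def by measurable
    show "g y \<le> G y * ennreal (1 / dist (fst y) (snd y) powr p)" for y
      unfolding g_def f_def[symmetric]
    proof (rule suminf_le_if_at_most_one_nonzero)
      show "(if n \<in> N then h (c n) y else 0) \<le> f y" for n
        using h_le[of "c n" y] c(1)[of n] D(1) by (simp add: subset_iff)
      show "i = j" if "(if i \<in> N then h (c i) y else 0) \<noteq> 0" "(if j \<in> N then h (c j) y else 0) \<noteq> 0" for i j
      proof -
        have "i \<in> N" "j \<in> N" "h (c i) y \<noteq> 0" "h (c j) y \<noteq> 0"
          using that by (auto split: if_splits)
        then have "c i = c j" by (intro h_disj[of "c i" "c j" y] c(1))
        then have "to_nat_on D (c i) = to_nat_on D (c j)" by (rule arg_cong)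
        then show "i = j"
          unfolding c(2)[OF \<open>i \<in> N\<close>] c(2)[OF \<open>j \<in> N\<close>] .
      qed
    qed
    show "g y = 0" if "2 * R < dist (fst y) (snd y)" for y
    proof -
      have "h (c n) y = 0" if "n \<in> N" for n
      proof (rule ccontr)
        assume "h (c n) y \<noteq> 0"
        then have "dist (fst y) (snd y) \<le> 2 * e (c n)" by (intro dist_B h_supp)
        moreover have "e (c n) < R" using e(2) c(1)[OF that] D(1) by blast
        ultimately show False using \<open>2 * R < dist (fst y) (snd y)\<close> by linarith
      qed
      then show ?thesis unfolding g_def by (simp cong: if_cong)
    qed
    have cover: "E \<subseteq> (\<Union>n. S n)"
    proof
      fix x assume "x \<in> E"
      then obtain z where z: "z \<in> D" "x \<in> cball z (3 * e z)" using D(3) by blast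
      then have "x \<in> S (to_nat_on D z)"
        using cD by (auto simp: S_def N_def c_def)
      then show "x \<in> (\<Union>n. S n)" by blast
    qed
    have diam: "ediameter (S n) \<le> ennreal (6 * R)" for n
    proof (cases "n \<in> N")
      case True
      then have cE: "c n \<in> E" using c(1) D(1) by blast
      have "diameter (cball (c n) (3 * e (c n))) \<le> 2 * (3 * e (c n))"
        using e(1)[OF cE] by (intro diameter_cball_le) simp
      then show ?thesis
        using True e(2)[OF cE] by (auto simp: S_def ediameter_def intro!: ennreal_leI)
    qed (simp add: S_def ediameter_def diameter_def)
    have pow: "diam_pow \<alpha> (S n) \<le> ennreal (6 powr \<alpha> * 2 powr p / \<kappa>) *
        (\<integral>\<^sup>+y. (if n \<in> N then h (c n) y else 0) \<partial>P)" for n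
    proof (cases "n \<in> N")
      case True
      then have cE: "c n \<in> E" using c(1) D(1) by blast
      have "diam_pow \<alpha> (S n) \<le> ennreal ((2 * (3 * e (c n))) powr \<alpha>)"
        using True diam_pow_cball_le[of "3 * e (c n)" \<alpha> "c n"] e(1)[OF cE] \<open>0 \<le> \<alpha>\<close>
        by (simp add: S_def)
      \<comment> \<open>The Vitali ball has diameter at most \<open>6 * e (c n)\<close>, which gives
        \<open>6 powr \<alpha>\<close>; the rest of the constant undoes the factor
        \<open>\<kappa> / 2 powr p\<close> in \<open>b\<close>.\<close>
      also have "(2 * (3 * e (c n))) powr \<alpha> = 6 powr \<alpha> * 2 powr p / \<kappa> * b (c n)"
        using e(1)[OF cE] \<open>0 < \<kappa>\<close> powr_mult[of 6 "e (c n)" \<alpha>] by (simp add: b_def)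
      also have "ennreal \<dots> = ennreal (6 powr \<alpha> * 2 powr p / \<kappa>) * ennreal (b (c n))"
        using \<open>0 < \<kappa>\<close> by (intro ennreal_mult) (auto intro: b_nonneg cE)
      also have "\<dots> \<le> ennreal (6 powr \<alpha> * 2 powr p / \<kappa>) * (\<integral>\<^sup>+y. h (c n) y \<partial>P)"
        by (intro mult_left_mono b_le cE) simp
      finally show ?thesis using True by simp
    qed (simp add: S_def diam_pow_def)
    have "hausdorff_content \<alpha> (6 * R) E \<le> (\<Sum>n. diam_pow \<alpha> (S n))"
      unfolding hausdorff_content_def using cover diam by (intro INF_lower) auto
    also have "\<dots> \<le> (\<Sum>n. ennreal (6 powr \<alpha> * 2 powr p / \<kappa>) *
        (\<integral>\<^sup>+y. (if n \<in> N then h (c n) y else 0) \<partial>P))"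
      using pow by (intro suminf_le) auto
    also have "\<dots> = ennreal (6 powr \<alpha> * 2 powr p / \<kappa>) *
        (\<Sum>n. \<integral>\<^sup>+y. (if n \<in> N then h (c n) y else 0) \<partial>P)"
      by simp
    also have "(\<Sum>n. \<integral>\<^sup>+y. (if n \<in> N then h (c n) y else 0) \<partial>P) = (\<integral>\<^sup>+y. g y \<partial>P)"
      unfolding g_def by (rule nn_integral_suminf[symmetric]) measurable
    finally show "hausdorff_content \<alpha> (6 * R) E \<le>
        ennreal (6 powr \<alpha> * 2 powr p / \<kappa>) * (\<integral>\<^sup>+y. g y \<partial>P)" .
  qed
qed

text \<open>Minorants for radii tending to 0 live ever closer to the diagonal, where the energy
  integrand is 0, so they tend to 0 pointwise. Dominated convergence sends their integrals to 0, and
  these control the content.\<close>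

lemma hausdorff_content_null_if_energy_density:
  fixes P :: "('a::metric_space \<times> 'a) measure" and G :: "'a \<times> 'a \<Rightarrow> ennreal"
  assumes G: "G \<in> borel_measurable P"
    and ball: "\<And>x t. cball x t \<times> cball x t \<in> sets P"
    and diag: "\<And>x. G (x, x) = 0"
    and energy: "(\<integral>\<^sup>+y. G y * ennreal (1 / dist (fst y) (snd y) powr p) \<partial>P) < \<infinity>"
    and "0 \<le> \<alpha>" "0 < p" "0 < \<kappa>" "0 < \<delta>"
    and E: "\<And>x \<delta>. x \<in> E \<Longrightarrow> 0 < \<delta> \<Longrightarrow> \<exists>e. 0 < e \<and> e < \<delta> \<and>
      ennreal (\<kappa> * e powr (\<alpha> + p)) \<le> (\<integral>\<^sup>+y\<in>cball x e \<times> cball x e. G y \<partial>P)"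
  shows "hausdorff_content \<alpha> \<delta> E = 0"
proof -
  define f where "f y = G y * ennreal (1 / dist (fst y) (snd y) powr p)" for y
  \<comment> \<open>The division by 6 gives \<open>6 * R n \<le> \<delta>\<close>, so the content at
    scale \<open>\<delta>\<close> is at most the content at scale \<open>6 * R n\<close>.\<close>
  define R where "R n = \<delta> / 6 / real (Suc n)" for n
  define K where "K = ennreal (6 powr \<alpha> * 2 powr p / \<kappa>)"
  have R_pos: "0 < R n" for n using \<open>0 < \<delta>\<close> by (simp add: R_def)
  have "\<forall>n. \<exists>g. g \<in> borel_measurable P \<and> (\<forall>y. g y \<le> f y) \<and>
      (\<forall>y. 2 * R n < dist (fst y) (snd y) \<longrightarrow> g y = 0) \<and>
      hausdorff_content \<alpha> (6 * R n) E \<le> K * (\<integral>\<^sup>+y. g y \<partial>P)"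
  proof
    fix n
    show "\<exists>g. g \<in> borel_measurable P \<and> (\<forall>y. g y \<le> f y) \<and>
      (\<forall>y. 2 * R n < dist (fst y) (snd y) \<longrightarrow> g y = 0) \<and>
      hausdorff_content \<alpha> (6 * R n) E \<le> K * (\<integral>\<^sup>+y. g y \<partial>P)"
    proof (rule hausdorff_content_le_minorant[OF G ball diag energy assms(5-7) R_pos[of n] E])
      fix g
      assume "g \<in> borel_measurable P"
        "\<And>y. g y \<le> G y * ennreal (1 / dist (fst y) (snd y) powr p)"
        "\<And>y. 2 * R n < dist (fst y) (snd y) \<Longrightarrow> g y = 0"
        "hausdorff_content \<alpha> (6 * R n) E \<le> ennreal (6 powr \<alpha> * 2 powr p / \<kappa>) * (\<integral>\<^sup>+y. g y \<partial>P)"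
      then show ?thesis
        unfolding f_def K_def by (intro exI[of _ g] conjI allI impI)
    qed
  qed
  from choice[OF this] obtain g where "\<forall>n. g n \<in> borel_measurable P \<and> (\<forall>y. g n y \<le> f y) \<and>
      (\<forall>y. 2 * R n < dist (fst y) (snd y) \<longrightarrow> g n y = 0) \<and>
      hausdorff_content \<alpha> (6 * R n) E \<le> K * (\<integral>\<^sup>+y. g n y \<partial>P)" ..
  then have g [measurable]: "g n \<in> borel_measurable P"
    and g_le: "g n y \<le> f y"
    and g_0: "2 * R n < dist (fst y) (snd y) \<Longrightarrow> g n y = 0"
    and content: "hausdorff_content \<alpha> (6 * R n) E \<le> K * (\<integral>\<^sup>+y. g n y \<partial>P)" for n y
    by (simp_all del: split_paired_All)
  have "R \<longlonglongrightarrow> 0"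
    unfolding R_def by (rule LIMSEQ_Suc) (rule lim_const_over_n)
  then have R_lim: "(\<lambda>n. 2 * R n) \<longlonglongrightarrow> 2 * 0" by (intro tendsto_mult tendsto_const)
  have lim: "(\<lambda>n. g n y) \<longlonglongrightarrow> 0" for y
  proof (cases "fst y = snd y")
    case True
    then have "f y = 0" using diag[of "fst y"] by (cases y) (simp add: f_def)
    then show ?thesis using g_le[of _ y] by simp
  next
    case False
    then have "\<forall>\<^sub>F n in sequentially. 2 * R n < dist (fst y) (snd y)"
      using order_tendstoD(2)[OF R_lim] by simp
    then show ?thesis
      by (intro tendsto_eventually) (auto elim!: eventually_mono intro: g_0)
  qed
  have "(\<lambda>n. \<integral>\<^sup>+y. g n y \<partial>P) \<longlonglongrightarrow> (\<integral>\<^sup>+y. 0 \<partial>P)"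
  \<comment> \<open>The dominating function must be measurable, which \<open>f\<close> need not be.
    The countable supremum of the \<open>g n\<close> is measurable and lies below
    \<open>f\<close>.\<close>
  proof (rule nn_integral_dominated_convergence[where w = "\<lambda>y. SUP n. g n y"])
    have "(\<integral>\<^sup>+y. (SUP n. g n y) \<partial>P) \<le> (\<integral>\<^sup>+y. f y \<partial>P)"
      by (intro nn_integral_mono SUP_least g_le)
    then show "(\<integral>\<^sup>+y. (SUP n. g n y) \<partial>P) < \<infinity>"
      using energy by (simp add: f_def)
    show "AE y in P. g j y \<le> (SUP n. g n y)" for j
      by (intro AE_I2 SUP_upper) simp
  qed (auto intro: lim)
  then have "(\<lambda>n. K * (\<integral>\<^sup>+y. g n y \<partial>P)) \<longlonglongrightarrow> K * 0"
    by (intro ennreal_tendsto_cmult) (auto simp: K_def)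
  moreover have "hausdorff_content \<alpha> \<delta> E \<le> K * (\<integral>\<^sup>+y. g n y \<partial>P)" for n
  proof -
    have "6 * R n \<le> \<delta>" using \<open>0 < \<delta>\<close> by (simp add: R_def field_simps)
    then show ?thesis using hausdorff_content_antimono content order_trans by blast
  qed
  ultimately have "hausdorff_content \<alpha> \<delta> E \<le> K * 0"
    by (intro LIMSEQ_le_const) auto
  then show ?thesis by simp
qed

section \<open>Borel sets and sigma-finiteness of the Caratheodory measure\<close>

lemma borel_sets_caratheodory_measure:
  assumes "borel_outer_measure \<mu>" "A \<in> sets borel"
  shows "A \<in> sets (caratheodory_measure \<mu>)" "emeasure (caratheodory_measure \<mu>) A = \<mu> A"
proof -
  have om: "outer_measure_space (Pow UNIV) \<mu>" and A: "A \<in> lambda_system UNIV (Pow UNIV) \<mu>"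
    using assms by (auto simp: borel_outer_measure_def)
  show "A \<in> sets (caratheodory_measure \<mu>)"
    using A by (simp add: sets_caratheodory_measure[OF om])
  show "emeasure (caratheodory_measure \<mu>) A = \<mu> A"
    by (rule emeasure_caratheodory_measure[OF om A])
qed

lemma sigma_finite_caratheodory_measure:
  fixes \<mu> :: "'a::metric_space set \<Rightarrow> ennreal"
  assumes "borel_outer_measure \<mu>" and fin: "\<And>x t. 0 < t \<Longrightarrow> \<mu> (cball x t) < \<infinity>"
  shows "sigma_finite_measure (caratheodory_measure \<mu>)"
proof
  fix x :: 'a
  have "(\<Union>n. cball x (real (Suc n))) = UNIV"
  proof -
    have "y \<in> (\<Union>n. cball x (real (Suc n)))" for y
    proof -
      obtain n where "dist x y \<le> real n" using real_arch_simple by blast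
      then have "y \<in> cball x (real (Suc n))" by simp
      then show ?thesis by blast
    qed
    then show ?thesis by blast
  qed
  then show "\<exists>A. countable A \<and> A \<subseteq> sets (caratheodory_measure \<mu>) \<and>
      \<Union>A = space (caratheodory_measure \<mu>) \<and> (\<forall>a\<in>A. emeasure (caratheodory_measure \<mu>) a \<noteq> \<infinity>)"
    using borel_sets_caratheodory_measure[OF assms(1)] fin[of "real (Suc _)"]
    by (intro exI[of _ "range (\<lambda>n. cball x (real (Suc n)))"]) (auto simp: less_top)
qed

section \<open>Points of large mean oscillation\<close>

definition mean_oscillation ::
  "real \<Rightarrow> ('a::metric_space set \<Rightarrow> ennreal) \<Rightarrow> ('a \<Rightarrow> 'b::metric_space) \<Rightarrow> 'a \<Rightarrow> real \<Rightarrow> ennreal"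
  where
  "mean_oscillation q \<mu> u x \<epsilon> =
     (\<integral>\<^sup>+z\<in>cball x \<epsilon>. (\<integral>\<^sup>+v\<in>cball x \<epsilon>. ennreal (dist (u z) (u v) powr q)
        \<partial>caratheodory_measure \<mu>) \<partial>caratheodory_measure \<mu>) / (\<mu> (cball x \<epsilon>))\<^sup>2"

text \<open>Countably many thresholds suffice for convergence to 0, so the exceptional set is a
  countable union.\<close>

lemma average_lebesgue_point_if_eventually_small:
  assumes small: "\<And>k::nat. \<exists>\<eta>>0. \<forall>\<epsilon>. 0 < \<epsilon> \<longrightarrow> \<epsilon> < \<eta> \<longrightarrow>
    mean_oscillation q \<mu> u x \<epsilon> \<le> ennreal (inverse (real (Suc k)))"
  shows "average_lebesgue_point q \<mu> u x"
  unfolding average_lebesgue_point_def mean_oscillation_def[symmetric]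
proof (rule order_tendstoI)
  fix a :: ennreal assume "0 < a"
  then obtain b where b: "0 < b" "b < a" using dense by blast
  then obtain b' where b': "b = ennreal b'" "0 < b'"
    by (cases b) auto
  obtain k where k: "inverse (real (Suc k)) < b'"
    using reals_Archimedean[OF b'(2)] by blast
  obtain \<eta> where \<eta>: "0 < \<eta>" "\<And>\<epsilon>. 0 < \<epsilon> \<Longrightarrow> \<epsilon> < \<eta> \<Longrightarrow>
    mean_oscillation q \<mu> u x \<epsilon> \<le> ennreal (inverse (real (Suc k)))"
    using small[of k] by blast
  have "mean_oscillation q \<mu> u x \<epsilon> < a" if "0 < \<epsilon>" "\<epsilon> < \<eta>" for \<epsilon>
    using \<eta>(2)[OF that] ennreal_leI[OF less_imp_le[OF k]] b(2) b'(1) by (meson le_less_trans order_trans)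
  then show "\<forall>\<^sub>F \<epsilon> in at_right 0. mean_oscillation q \<mu> u x \<epsilon> < a"
    unfolding eventually_at_right_field using \<eta>(1) by blast
qed simp

text \<open>Multiplying the oscillation by \<open>(\<mu> B)\<^sup>2\<close> and using the lower
  regularity bound turns large oscillation into the density hypothesis of the previous part, with
  \<open>\<kappa> = \<theta> * c\<^sup>2\<close>.\<close>

lemma large_mean_oscillation_content_null:
  fixes \<mu> :: "'a::metric_space set \<Rightarrow> ennreal" and u :: "'a \<Rightarrow> 'b::metric_space"
  assumes "0 < s" and ahlfors: "ahlfors_regular s \<mu>"
    and ball: "\<And>x t. 0 < t \<Longrightarrow> 0 < \<mu> (cball x t) \<and> \<mu> (cball x t) < \<infinity>"
    and "0 < r" "0 < q" "r * q \<le> s"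
    and sobolev: "frac_sobolev_loc s r q \<mu> u"
    and "0 \<le> t" "0 < \<theta>" "0 < \<delta>"
  shows "hausdorff_content (s - r * q) \<delta> {x\<in>cball x0 t. \<forall>\<eta>>0. \<exists>\<epsilon>. 0 < \<epsilon> \<and> \<epsilon> < \<eta> \<and>
    ennreal \<theta> < mean_oscillation q \<mu> u x \<epsilon>} = 0" (is "hausdorff_content _ _ ?E = 0")
proof -
  define M where "M = caratheodory_measure \<mu>"
  define P where "P = product_measure \<mu>"
  \<comment> \<open>The margin 1 ensures that balls of radius below 1 about points of
    \<open>cball x0 t\<close> stay in \<open>A\<close>, where the energy is finite.\<close>
  define A where "A = cball x0 (t + 1)"
  define p where "p = r * q + s"
  \<comment> \<open>The kernel is kept out of \<open>G\<close> because it need not be measurable.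
    The indicator extends measurability from \<open>A \<times> A\<close> to the whole
    product.\<close>
  define G :: "'a \<times> 'a \<Rightarrow> ennreal" where
    "G y = ennreal (dist (u (fst y)) (u (snd y)) powr q) * indicator (A \<times> A) y" for y
  have P_eq: "P = completion (M \<Otimes>\<^sub>M M)" by (simp add: P_def M_def product_measure_def)
  have borel: "borel_outer_measure \<mu>" using ahlfors by (simp add: ahlfors_regular_def)
  have cball_M: "cball x e \<in> sets M" for x e
    unfolding M_def by (intro borel_sets_caratheodory_measure borel borel_closed closed_cball)
  then have cball_P: "cball x e \<times> cball x e \<in> sets P" for x e
    unfolding P_eq by (intro sets_completionI_sets pair_measureI)
  interpret sigma_finite_measure M
    unfolding M_def using sigma_finite_caratheodory_measure[OF borel] ball by blast
  have "frac_sobolev s r q \<mu> A u"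
    using sobolev \<open>0 \<le> t\<close> by (simp add: frac_sobolev_loc_def A_def)
  then have F: "(\<lambda>(x, z). dist (u x) (u z)) \<in> borel_measurable (restrict_space P (A \<times> A))"
    and energy: "(\<integral>\<^sup>+(x, z)\<in>A \<times> A. ennreal (dist (u x) (u z) powr q / dist x z powr p) \<partial>P) < \<infinity>"
    by (simp_all add: frac_sobolev_def Lq_loc_def P_def p_def)
  have "(\<lambda>y. ennreal ((\<lambda>(x, z). dist (u x) (u z)) y powr q)) \<in> borel_measurable (restrict_space P (A \<times> A))"
    using F by measurable
  then have G_meas: "G \<in> borel_measurable P"
    using cball_P[of x0 "t + 1"]
    by (subst (asm) borel_measurable_restrict_space_iff_ennreal)
       (auto simp: A_def[symmetric] G_def[abs_def] split_beta)
  obtain c where "0 < c" and c: "\<And>x t. 0 < t \<Longrightarrow> ennreal t < ediameter (UNIV :: 'a set) \<Longrightarrow>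
      ennreal (c * t powr s) \<le> \<mu> (cball x t)"
    using ahlfors unfolding ahlfors_regular_def by blast
  show ?thesis
  proof (rule hausdorff_content_null_if_energy_density[where P = P and G = G and p = p and
        \<kappa> = "\<theta> * c\<^sup>2"])
    show "G \<in> borel_measurable P" by (rule G_meas)
    show "\<And>x e. cball x e \<times> cball x e \<in> sets P" by (rule cball_P)
    show "G (x, x) = 0" for x using \<open>0 < q\<close> by (simp add: G_def)
    show "0 \<le> s - r * q" "0 < p" "0 < \<theta> * c\<^sup>2" "0 < \<delta>"
      using assms \<open>0 < c\<close> by (simp_all add: p_def add_pos_pos)
    have "(\<integral>\<^sup>+y. G y * ennreal (1 / dist (fst y) (snd y) powr p) \<partial>P) =
      (\<integral>\<^sup>+(x, z)\<in>A \<times> A. ennreal (dist (u x) (u z) powr q / dist x z powr p) \<partial>P)"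
    proof (rule nn_integral_cong)
      fix y
      show "G y * ennreal (1 / dist (fst y) (snd y) powr p) =
        (case y of (x, z) \<Rightarrow> ennreal (dist (u x) (u z) powr q / dist x z powr p)) * indicator (A \<times> A) y"
        by (cases "y \<in> A \<times> A") (simp_all add: G_def split_beta ennreal_mult[symmetric])
    qed
    then show "(\<integral>\<^sup>+y. G y * ennreal (1 / dist (fst y) (snd y) powr p) \<partial>P) < \<infinity>"
      using energy by simp
  next
    fix x and \<eta> :: real assume x: "x \<in> ?E" and "0 < \<eta>"
    then have x0: "dist x0 x \<le> t" and
      x_osc: "\<And>\<eta>. 0 < \<eta> \<Longrightarrow> \<exists>\<epsilon>. 0 < \<epsilon> \<and> \<epsilon> < \<eta> \<and> ennreal \<theta> < mean_oscillation q \<mu> u x \<epsilon>"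
      by simp_all
    \<comment> \<open>A one-point space has diameter 0, so regularity says nothing there, but its
      oscillation is 0. Otherwise a radius below \<open>dist z v\<close> is below the diameter, and
      the lower bound applies.\<close>
    have "\<exists>z v :: 'a. z \<noteq> v"
    proof (rule ccontr)
      assume "\<not> ?thesis"
      then have zero: "ennreal (dist (u z) (u v) powr q) = 0" for z v
        by (metis dist_self ennreal_0 powr_0)
      have "mean_oscillation q \<mu> u x \<epsilon> = 0" for \<epsilon>
        unfolding mean_oscillation_def zero by simp
      then show False using x_osc[OF zero_less_one] by simp
    qed
    then obtain z v :: 'a where "z \<noteq> v" by blast
    define \<eta>' where "\<eta>' = min \<eta> (min 1 (dist z v))"
    have "0 < \<eta>'" using \<open>0 < \<eta>\<close> \<open>z \<noteq> v\<close> by (simp add: \<eta>'_def)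
    then obtain \<epsilon> where \<epsilon>: "0 < \<epsilon>" "\<epsilon> < \<eta>'" "ennreal \<theta> < mean_oscillation q \<mu> u x \<epsilon>"
      using x_osc by blast
    define B where "B = cball x \<epsilon>"
    define I where "I = (\<integral>\<^sup>+y\<in>B \<times> B. G y \<partial>P)"
    have "B \<subseteq> A"
    proof
      fix w assume "w \<in> B"
      then show "w \<in> A"
        using x0 \<epsilon>(2) dist_triangle[of x0 w x] by (auto simp: B_def A_def \<eta>'_def)
    qed
    have "ennreal \<epsilon> < ediameter (UNIV :: 'a set)"
    proof (cases "bounded (UNIV :: 'a set)")
      case True
      then have "dist z v \<le> diameter (UNIV :: 'a set)" by (intro diameter_bounded_bound) auto
      then show ?thesis using \<epsilon>(1,2) True by (auto simp: ediameter_def \<eta>'_def ennreal_less_iff)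
    qed (simp add: ediameter_def)
    with c \<epsilon>(1) have cB: "ennreal (c * \<epsilon> powr s) \<le> \<mu> B" by (simp add: B_def)
    have m: "\<mu> B \<noteq> 0" "\<mu> B < top"
      using ball[OF \<epsilon>(1), of x] by (simp_all add: B_def less_imp_neq[symmetric])
    have "(\<integral>\<^sup>+z\<in>B. (\<integral>\<^sup>+v\<in>B. ennreal (dist (u z) (u v) powr q) \<partial>M) \<partial>M) =
        (\<integral>\<^sup>+z. \<integral>\<^sup>+v. G (z, v) * indicator (B \<times> B) (z, v) \<partial>M \<partial>M)"
    proof (rule nn_integral_cong)
      fix z
      have G_B: "G (z, v) * indicator (B \<times> B) (z, v) =
          ennreal (dist (u z) (u v) powr q) * indicator B v * indicator B z" for v
        using subsetD[OF \<open>B \<subseteq> A\<close>, of z] subsetD[OF \<open>B \<subseteq> A\<close>, of v]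
        by (cases "z \<in> B"; cases "v \<in> B") (simp_all add: G_def)
      show "(\<integral>\<^sup>+v\<in>B. ennreal (dist (u z) (u v) powr q) \<partial>M) * indicator B z =
          (\<integral>\<^sup>+v. G (z, v) * indicator (B \<times> B) (z, v) \<partial>M)"
        unfolding G_B by (cases "z \<in> B") simp_all
    qed
    also have "\<dots> = I"
      unfolding I_def P_eq
    proof (rule iterated_nn_integral_completion)
      show "(\<lambda>y. G y * indicator (B \<times> B) y) \<in> borel_measurable (completion (M \<Otimes>\<^sub>M M))"
        using G_meas cball_P[of x \<epsilon>] unfolding P_eq B_def
        by (intro borel_measurable_times_ennreal borel_measurable_indicator)
    qed (rule sigma_finite_measure_axioms)
    finally have osc: "mean_oscillation q \<mu> u x \<epsilon> = I / (\<mu> B)\<^sup>2"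
      by (simp add: mean_oscillation_def M_def B_def)
    \<comment> \<open>The exponents match because \<open>(s - r * q) + p = 2 * s\<close>, the
      exponent of the squared lower bound for \<open>\<mu> B\<close>.\<close>
    have "ennreal (\<theta> * c\<^sup>2 * \<epsilon> powr (s - r * q + p)) = ennreal \<theta> * (ennreal (c * \<epsilon> powr s))\<^sup>2"
    proof -
      have "\<theta> * c\<^sup>2 * \<epsilon> powr (s - r * q + p) = \<theta> * (c * \<epsilon> powr s)\<^sup>2"
        using powr_add[of \<epsilon> s s] by (simp add: p_def power2_eq_square)
      moreover have "0 \<le> c * \<epsilon> powr s" using \<open>0 < c\<close> by simp
      ultimately show ?thesis
        using \<open>0 < \<theta>\<close> by (simp only: ennreal_power ennreal_mult' less_imp_le)
    qed
    also have "\<dots> \<le> ennreal \<theta> * (\<mu> B)\<^sup>2"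
      by (intro mult_left_mono power_mono cB) simp_all
    also have "\<dots> \<le> I / (\<mu> B)\<^sup>2 * (\<mu> B)\<^sup>2"
      using \<epsilon>(3) by (intro mult_right_mono) (simp_all add: osc less_imp_le)
    also have "\<dots> = I"
    proof -
      have "(\<mu> B)\<^sup>2 \<noteq> 0" "(\<mu> B)\<^sup>2 < top"
        using m by (simp_all add: power2_eq_square ennreal_mult_less_top)
      then show ?thesis unfolding ennreal_divide_times by simp
    qed
    finally show "\<exists>e. 0 < e \<and> e < \<eta> \<and> ennreal (\<theta> * c\<^sup>2 * e powr (s - r * q + p)) \<le>
        (\<integral>\<^sup>+y\<in>cball x e \<times> cball x e. G y \<partial>P)"
      using \<epsilon>(1,2) by (intro exI[of _ \<epsilon>]) (simp add: I_def B_def \<eta>'_def)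
  qed
qed

theorem theorem1p6:
  fixes \<mu> :: "'a::metric_space set \<Rightarrow> ennreal"
    and u :: "'a \<Rightarrow> 'b::metric_space"
    and s r q :: real
  assumes "0 < s"
    and "ahlfors_regular s \<mu>"
    and "\<And>x t. 0 < t \<Longrightarrow> 0 < \<mu> (cball x t) \<and> \<mu> (cball x t) < \<infinity>"
    and "0 < r" and "r < 1" and "0 < q" and "r * q \<le> s"
    and "frac_sobolev_loc s r q \<mu> u"
  shows "hausdorff_measure (s - r * q) {x. \<not> average_lebesgue_point q \<mu> u x} = 0"
proof -
  fix x0 :: 'a
  \<comment> \<open>Finite energy is available only on balls, so the space is exhausted by balls
    about an arbitrary point, in addition to splitting by thresholds.\<close>
  define E where "E n k = {x\<in>cball x0 (real n). \<forall>\<eta>>0. \<exists>\<epsilon>. 0 < \<epsilon> \<and> \<epsilon> < \<eta> \<and>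
    ennreal (inverse (real (Suc k))) < mean_oscillation q \<mu> u x \<epsilon>}" for n k
  \<comment> \<open>The measure is the supremum of the contents over all scales, so countable unions
    can be treated at each fixed scale.\<close>
  have "hausdorff_content (s - r * q) \<delta> {x. \<not> average_lebesgue_point q \<mu> u x} = 0"
    if "0 < \<delta>" for \<delta>
  proof -
    have "{x. \<not> average_lebesgue_point q \<mu> u x} \<subseteq> (\<Union>n. \<Union>k. E n k)"
    proof
      fix x assume "x \<in> {x. \<not> average_lebesgue_point q \<mu> u x}"
      then have "\<not> average_lebesgue_point q \<mu> u x" by simp
      then obtain k where k: "\<not> (\<exists>\<eta>>0. \<forall>\<epsilon>. 0 < \<epsilon> \<longrightarrow> \<epsilon> < \<eta> \<longrightarrow>
          mean_oscillation q \<mu> u x \<epsilon> \<le> ennreal (inverse (real (Suc k))))"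
        using average_lebesgue_point_if_eventually_small by blast
      obtain n where "dist x0 x \<le> real n" using real_arch_simple by blast
      then have "x \<in> E n k" using k unfolding E_def by (simp add: not_le)
      then show "x \<in> (\<Union>n. \<Union>k. E n k)" by blast
    qed
    then have "hausdorff_content (s - r * q) \<delta> {x. \<not> average_lebesgue_point q \<mu> u x}
        \<le> hausdorff_content (s - r * q) \<delta> (\<Union>n. \<Union>k. E n k)"
      unfolding hausdorff_content_def by (intro INF_superset_mono) auto
    also have "\<dots> = 0"
    proof (intro hausdorff_content_countable_Union_null)
      fix n k
      show "hausdorff_content (s - r * q) \<delta> (E n k) = 0"
        unfolding E_def
        by (rule large_mean_oscillation_content_null[OF assms(1-4) assms(6-8)]) (use that in simp_all)
    qed
    finally show ?thesis by simp
  qed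
  then have "(SUP \<delta>\<in>{0<..}. hausdorff_content (s - r * q) \<delta> {x. \<not> average_lebesgue_point q \<mu> u x}) = 0"
    by (intro SUP_eq_const) auto
  then show ?thesis unfolding hausdorff_measure_eq_SUP .
qed

end
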